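(* Let $G$ be a topological group and let $d$ be a right-invariant metric generating the topology of $G$. Suppose that there exist a dense subset $D\subseteq[0,1]$ with $\{0,1\}\subseteq D$ and a family of continuous endomorphisms $\phi_t\colon G\to G$ $(t\in D)$ such that (1) $\phi_0(G)=\{e\}$ and $\phi_1(G)=G$; (2) if $s,t\in D$ and $s\le t$, then $\phi_s(G)\subseteq\phi_t(G)$; (3) there exists a real $C\ge 0$ such that $d(g\phi_s(h),g\phi_t(h))\le C\cdot|s-t|$ for all $s,t\in D$ and all $g,h\in G$. If $G$ is amenable, then $G$ is extremely amenable.
   Context: A metric $d$ on a group $G$ is right-invariant if $d(xg,yg)=d(x,y)$ for all $g,x,y\in G$. Endomorphism means group endomorphism. For a topological group $G$, $\mathrm{RUCB}(G)$ is the algebra of all bounded functions $f\colon G\to\mathbb{R}$ such that for every $\epsilon>0$ there is a neighborhood $U$ of $e$ with $\sup_{x\in G}|f(x)-f(gx)|\le\epsilon$ for all $g\in U$. $G$ is amenable if there is a positive unital linear functional $\mu\colon\mathrm{RUCB}(G)\to\mathbb{R}$ with $\mu(f\circ\lambda_g)=\mu(f)$ for all $f\in\mathrm{RUCB}(G)$, $g\in G$, where $\lambda_g(x)=gx$ (equivalently, every continuous action of $G$ on a non-empty compact Hausdorff space admits an invariant regular Borel probability measure). $G$ is extremely amenable if every (jointly) continuous action of $G$ on a non-empty compact Hausdorff space has a fixed point. *)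

theory Defs
  imports "HOL-Analysis.Analysis"
begin

text \<open>
  A topological group is a type of the library class \<open>topological_group_add\<close>. The class is not
  commutative; the group is merely written additively, so \<open>x + y\<close> stands for the product \<open>xy\<close>,
  \<open>0\<close> for the neutral element \<open>e\<close>, and the order of summands matters.
\<close>

definition right_invariant :: "('g::group_add \<Rightarrow> 'g \<Rightarrow> real) \<Rightarrow> bool" where
  "right_invariant d \<longleftrightarrow> (\<forall>g x y. d (x + g) (y + g) = d x y)"

definition endomorphism :: "('g::group_add \<Rightarrow> 'g) \<Rightarrow> bool" where
  "endomorphism f \<longleftrightarrow> (\<forall>x y. f (x + y) = f x + f y)"

text \<open>
  The supremum below is a genuine one, since \<open>f\<close> is required to be bounded.
\<close>

definition RUCB :: "('g::topological_group_add \<Rightarrow> real) set" where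
  "RUCB = {f. bounded (range f) \<and>
     (\<forall>\<epsilon>>0. \<exists>U. open U \<and> 0 \<in> U \<and> (\<forall>g\<in>U. (SUP x. \<bar>f x - f (g + x)\<bar>) \<le> \<epsilon>))}"

text \<open>
  A functional on \<open>RUCB\<close> is a total function on all of \<open>'g \<Rightarrow> real\<close> whose values outside \<open>RUCB\<close>
  are irrelevant; all conditions are therefore relativised to \<open>RUCB\<close>.
\<close>

definition invariant_mean :: "(('g::topological_group_add \<Rightarrow> real) \<Rightarrow> real) \<Rightarrow> bool" where
  "invariant_mean \<mu> \<longleftrightarrow>
     (\<forall>f\<in>RUCB. \<forall>h\<in>RUCB. \<mu> (\<lambda>x. f x + h x) = \<mu> f + \<mu> h) \<and>
     (\<forall>c. \<forall>f\<in>RUCB. \<mu> (\<lambda>x. c * f x) = c * \<mu> f) \<and>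
     (\<forall>f\<in>RUCB. (\<forall>x. 0 \<le> f x) \<longrightarrow> 0 \<le> \<mu> f) \<and>
     \<mu> (\<lambda>x. 1) = 1 \<and>
     (\<forall>f\<in>RUCB. \<forall>g. \<mu> (f \<circ> (\<lambda>x. g + x)) = \<mu> f)"

definition amenable :: "'g::topological_group_add itself \<Rightarrow> bool" where
  "amenable (_ :: 'g itself) \<longleftrightarrow> (\<exists>\<mu> :: ('g \<Rightarrow> real) \<Rightarrow> real. invariant_mean \<mu>)"

definition continuous_action ::
    "'x topology \<Rightarrow> ('g::topological_group_add \<Rightarrow> 'x \<Rightarrow> 'x) \<Rightarrow> bool" where
  "continuous_action X act \<longleftrightarrow>
     (\<forall>x\<in>topspace X. act 0 x = x) \<and>
     (\<forall>g h. \<forall>x\<in>topspace X. act (g + h) x = act g (act h x)) \<and>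
     continuous_map (prod_topology euclidean X) X (\<lambda>(g, x). act g x)"

text \<open>
  HOL cannot quantify over types inside a formula, so the type \<open>'x\<close> in which the points of the
  compact spaces live is a parameter. Extreme amenability proper is the statement with \<open>'x\<close> a free
  type variable, i.e. for every type \<open>'x\<close>.
\<close>

definition extremely_amenable ::
    "'g::topological_group_add itself \<Rightarrow> 'x itself \<Rightarrow> bool" where
  "extremely_amenable (_ :: 'g itself) (_ :: 'x itself) \<longleftrightarrow>
     (\<forall>(X :: 'x topology) (act :: 'g \<Rightarrow> 'x \<Rightarrow> 'x).
        topspace X \<noteq> {} \<and> compact_space X \<and> Hausdorff_space X \<and> continuous_action X act \<longrightarrow>
        (\<exists>x\<in>topspace X. \<forall>g. act g x = x))"

end

theory Submission
  imports Defs
begin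

text \<open>
  Let \<open>\<mu>\<close> be an invariant mean and choose \<open>t\<^sub>0 = 0, \<dots>, t\<^sub>n = 1\<close> in \<open>D\<close> with steps at most \<open>3/n\<close>. The
  operators \<open>E\<^sub>i f(x) = \<mu>(k \<mapsto> f(x \<phi>\<^bsub>t\<^sub>i\<^esub>(k)))\<close> commute with left translations, hence preserve Lipschitz
  constants, and \<open>E\<^sub>i f\<close> is invariant under right translation by \<open>\<phi>\<^bsub>t\<^sub>i\<^esub>(G)\<close>. As \<open>\<phi>\<^sub>1\<close> is onto,
  \<open>\<nu> = E\<^sub>n \<dots> E\<^sub>1\<close> takes constant values and is again an invariant mean. For an \<open>L\<close>-Lipschitz \<open>f\<close>, the
  function \<open>E\<^sub>i \<dots> E\<^sub>1 f\<close> oscillates by at most \<open>3CL/n\<close> from \<open>x\<close> to any point of \<open>x \<phi>\<^bsub>t\<^sub>i\<^sub>+\<^sub>1\<^esub>(G)\<close>, so every step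
  adds at most \<open>(3CL/n)\<^sup>2\<close> to the variance, and the variance of \<open>f\<close> under \<open>\<nu>\<close> is at most
  \<open>9C\<^sup>2L\<^sup>2/n\<close>. Lipschitz functions are dense in \<open>RUCB\<close>, so finitely many functions in \<open>RUCB\<close> are
  simultaneously almost constant for a suitable invariant mean, which yields points that are almost
  fixed under finitely many group elements. Compactness turns these into a fixed point.
\<close>

section \<open>Right uniformly continuous bounded functions\<close>

text \<open>For bounded \<open>f\<close> the differences are bounded by twice the bound of
  \<open>f\<close>, so their supremum is at most \<epsilon> exactly when each of them is. Everything
  below works with this pointwise form.\<close>

lemma RUCB_iff:
  fixes f :: "'g::topological_group_add \<Rightarrow> real"
  shows "f \<in> RUCB \<longleftrightarrow> (\<exists>B. \<forall>x. \<bar>f x\<bar> \<le> B) \<and>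
     (\<forall>\<epsilon>>0. \<exists>U. open U \<and> 0 \<in> U \<and> (\<forall>g\<in>U. \<forall>x. \<bar>f x - f (g + x)\<bar> \<le> \<epsilon>))"
proof -
  have "(SUP x. \<bar>f x - f (g + x)\<bar>) \<le> \<epsilon> \<longleftrightarrow> (\<forall>x. \<bar>f x - f (g + x)\<bar> \<le> \<epsilon>)"
    if B: "\<forall>x. \<bar>f x\<bar> \<le> B" for B g \<epsilon>
  proof -
    have "\<bar>f x - f (g + x)\<bar> \<le> 2 * B" for x
      using B[rule_format, of x] B[rule_format, of "g + x"] by linarith
    then have "bdd_above (range (\<lambda>x. \<bar>f x - f (g + x)\<bar>))"
      by (auto simp: bdd_above_def)
    then show ?thesis
      using cSUP_le_iff[of UNIV "\<lambda>x. \<bar>f x - f (g + x)\<bar>" \<epsilon>] by blast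
  qed
  moreover have "bounded (range f) \<longleftrightarrow> (\<exists>B. \<forall>x. \<bar>f x\<bar> \<le> B)"
    by (auto simp: bounded_iff)
  ultimately show ?thesis
    unfolding RUCB_def by auto
qed

lemma RUCB_bounded:
  assumes "f \<in> RUCB"
  obtains B where "B > 0" "\<And>x. \<bar>f x\<bar> \<le> B"
proof -
  obtain B where B: "\<And>x. \<bar>f x\<bar> \<le> B"
    using assms by (auto simp: RUCB_iff)
  have "\<bar>f x\<bar> \<le> \<bar>B\<bar> + 1" for x
    using B[of x] by linarith
  then show thesis
    by (intro that[of "\<bar>B\<bar> + 1"]) auto
qed

lemma RUCB_uniform:
  assumes "f \<in> RUCB" "\<epsilon> > 0"
  obtains U where "open U" "0 \<in> U" "\<And>g x. g \<in> U \<Longrightarrow> \<bar>f x - f (g + x)\<bar> \<le> \<epsilon>"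
proof -
  have "\<exists>U. open U \<and> 0 \<in> U \<and> (\<forall>g\<in>U. \<forall>x. \<bar>f x - f (g + x)\<bar> \<le> \<epsilon>)"
    using assms by (simp add: RUCB_iff)
  then show thesis using that by metis
qed

lemma RUCB_const: "(\<lambda>x. c) \<in> RUCB"
  unfolding RUCB_iff
proof (intro conjI allI impI)
  show "\<exists>B. \<forall>x. \<bar>c\<bar> \<le> B" by blast
next
  fix \<epsilon> :: real assume "\<epsilon> > 0"
  then show "\<exists>U. open U \<and> 0 \<in> U \<and> (\<forall>g\<in>U. \<forall>x. \<bar>c - c\<bar> \<le> \<epsilon>)"
    by (intro exI[of _ UNIV]) simp
qed

lemma RUCB_add:
  assumes f: "f \<in> RUCB" and h: "h \<in> RUCB"
  shows "(\<lambda>x. f x + h x) \<in> RUCB"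
  unfolding RUCB_iff
proof (intro conjI allI impI)
  obtain A B where "\<And>x. \<bar>f x\<bar> \<le> A" "\<And>x. \<bar>h x\<bar> \<le> B"
    using RUCB_bounded f h by metis
  then have "\<bar>f x + h x\<bar> \<le> A + B" for x
    by (meson abs_triangle_ineq add_mono order_trans)
  then show "\<exists>B. \<forall>x. \<bar>f x + h x\<bar> \<le> B" by blast
next
  fix \<epsilon> :: real assume "\<epsilon> > 0"
  then have "\<epsilon> / 2 > 0" by simp
  obtain U where U: "open U" "0 \<in> U" "\<And>g x. g \<in> U \<Longrightarrow> \<bar>f x - f (g + x)\<bar> \<le> \<epsilon> / 2"
    using RUCB_uniform[OF f \<open>\<epsilon> / 2 > 0\<close>] by blast
  obtain V where V: "open V" "0 \<in> V" "\<And>g x. g \<in> V \<Longrightarrow> \<bar>h x - h (g + x)\<bar> \<le> \<epsilon> / 2"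
    using RUCB_uniform[OF h \<open>\<epsilon> / 2 > 0\<close>] by blast
  have "\<bar>f x + h x - (f (g + x) + h (g + x))\<bar> \<le> \<epsilon>" if "g \<in> U \<inter> V" for g x
    using U(3)[of g x] V(3)[of g x] that unfolding Int_iff by argo
  then show "\<exists>U. open U \<and> 0 \<in> U \<and> (\<forall>g\<in>U. \<forall>x. \<bar>f x + h x - (f (g + x) + h (g + x))\<bar> \<le> \<epsilon>)"
    using U V by (intro exI[of _ "U \<inter> V"]) auto
qed

lemma RUCB_mult:
  assumes f: "f \<in> RUCB" and h: "h \<in> RUCB"
  shows "(\<lambda>x. f x * h x) \<in> RUCB"
  unfolding RUCB_iff
proof (intro conjI allI impI)
  obtain A B where A: "A > 0" "\<And>x. \<bar>f x\<bar> \<le> A" and B: "B > 0" "\<And>x. \<bar>h x\<bar> \<le> B"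
    using RUCB_bounded f h by metis
  then have "\<bar>f x * h x\<bar> \<le> A * B" for x
    unfolding abs_mult by (intro mult_mono) auto
  then show "\<exists>B. \<forall>x. \<bar>f x * h x\<bar> \<le> B" by blast
  fix \<epsilon> :: real assume "\<epsilon> > 0"
  define \<delta> where "\<delta> = \<epsilon> / (A + B)"
  have "\<delta> > 0" using A(1) B(1) \<open>\<epsilon> > 0\<close> by (simp add: \<delta>_def)
  have "A * \<delta> + \<delta> * B = (A + B) * \<delta>" by (simp add: algebra_simps)
  also have "\<dots> = \<epsilon>" using A(1) B(1) by (simp add: \<delta>_def)
  finally have \<epsilon>: "A * \<delta> + \<delta> * B = \<epsilon>" .
  obtain U where U: "open U" "0 \<in> U" "\<And>g x. g \<in> U \<Longrightarrow> \<bar>f x - f (g + x)\<bar> \<le> \<delta>"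
    using RUCB_uniform[OF f \<open>\<delta> > 0\<close>] by blast
  obtain V where V: "open V" "0 \<in> V" "\<And>g x. g \<in> V \<Longrightarrow> \<bar>h x - h (g + x)\<bar> \<le> \<delta>"
    using RUCB_uniform[OF h \<open>\<delta> > 0\<close>] by blast
  have "\<bar>f x * h x - f (g + x) * h (g + x)\<bar> \<le> \<epsilon>" if "g \<in> U \<inter> V" for g x
  proof -
    have "f x * h x - f (g + x) * h (g + x)
        = f x * (h x - h (g + x)) + (f x - f (g + x)) * h (g + x)"
      by (simp add: algebra_simps)
    also have "\<bar>\<dots>\<bar> \<le> \<bar>f x\<bar> * \<bar>h x - h (g + x)\<bar> + \<bar>f x - f (g + x)\<bar> * \<bar>h (g + x)\<bar>"
      by (metis abs_mult abs_triangle_ineq)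
    also have "\<dots> \<le> A * \<delta> + \<delta> * B"
      using that A B U(3)[of g x] V(3)[of g x] \<open>\<delta> > 0\<close> by (intro add_mono mult_mono) auto
    finally show ?thesis using \<epsilon> by simp
  qed
  then show "\<exists>U. open U \<and> 0 \<in> U \<and> (\<forall>g\<in>U. \<forall>x. \<bar>f x * h x - f (g + x) * h (g + x)\<bar> \<le> \<epsilon>)"
    using U V by (intro exI[of _ "U \<inter> V"]) auto
qed

lemma RUCB_cmult: "f \<in> RUCB \<Longrightarrow> (\<lambda>x. c * f x) \<in> RUCB"
  by (rule RUCB_mult[OF RUCB_const])

lemma RUCB_diff: "f \<in> RUCB \<Longrightarrow> h \<in> RUCB \<Longrightarrow> (\<lambda>x. f x - h x) \<in> RUCB"
  using RUCB_add[of f "\<lambda>x. (-1) * h x"] RUCB_cmult[of h "-1"] by simp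

lemma RUCB_square: "f \<in> RUCB \<Longrightarrow> (\<lambda>x. (f x)\<^sup>2) \<in> RUCB"
  unfolding power2_eq_square by (rule RUCB_mult)

lemma RUCB_sum:
  assumes "\<And>i. i \<in> I \<Longrightarrow> f i \<in> RUCB"
  shows "(\<lambda>x. \<Sum>i\<in>I. f i x) \<in> RUCB"
  using assms
proof (induction I rule: infinite_finite_induct)
  case (insert i I)
  then have "(\<lambda>x. f i x + (\<Sum>i\<in>I. f i x)) \<in> RUCB"
    by (intro RUCB_add) auto
  then show ?case
    using insert.hyps by simp
qed (simp_all add: RUCB_const)

lemmas RUCB_intros =
  RUCB_const RUCB_add RUCB_mult RUCB_cmult RUCB_diff RUCB_square RUCB_sum

section \<open>Right uniform continuity along endomorphisms and translations\<close>

lemma endomorphism_zero: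
  assumes "endomorphism \<psi>"
  shows "\<psi> 0 = 0"
proof -
  have "\<psi> 0 + \<psi> 0 = \<psi> 0 + 0"
    using assms unfolding endomorphism_def by (metis add_0_right)
  then show ?thesis
    by (simp only: add_left_cancel)
qed

text \<open>Translating \<open>k\<close> on the left by \<open>g\<close> translates
  \<open>x + \<psi> k\<close> on the left by the conjugate \<open>x + \<psi> g - x\<close>, which by
  continuity of \<open>\<psi>\<close> is close to 0 for \<open>g\<close> close to 0. So a mean may
  be applied in the variable \<open>k\<close>.\<close>

lemma RUCB_compose_endomorphism:
  fixes f :: "'g::topological_group_add \<Rightarrow> real"
  assumes f: "f \<in> RUCB" and \<psi>: "endomorphism \<psi>" "continuous_on UNIV \<psi>"
  shows "(\<lambda>k. f (x + \<psi> k)) \<in> RUCB"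
  unfolding RUCB_iff
proof (intro conjI allI impI)
  show "\<exists>B. \<forall>k. \<bar>f (x + \<psi> k)\<bar> \<le> B"
    using f by (auto simp: RUCB_iff)
next
  fix \<epsilon> :: real assume "\<epsilon> > 0"
  then obtain U where U: "open U" "0 \<in> U" "\<And>g y. g \<in> U \<Longrightarrow> \<bar>f y - f (g + y)\<bar> \<le> \<epsilon>"
    using RUCB_uniform[OF f] by blast
  define V where "V = (\<lambda>g. x + \<psi> g - x) -` U"
  have "open V"
    unfolding V_def by (intro open_vimage U continuous_intros continuous_on_add \<psi>)
  moreover have "0 \<in> V"
    using U(2) by (simp add: V_def endomorphism_zero[OF \<psi>(1)])
  moreover have "\<bar>f (x + \<psi> k) - f (x + \<psi> (g + k))\<bar> \<le> \<epsilon>" if "g \<in> V" for g k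
  proof -
    have "x + \<psi> (g + k) = (x + \<psi> g - x) + (x + \<psi> k)"
      using \<psi>(1) by (simp add: endomorphism_def add.assoc[symmetric])
    then show ?thesis
      using U(3)[of "x + \<psi> g - x" "x + \<psi> k"] that by (simp add: V_def)
  qed
  ultimately show "\<exists>U. open U \<and> 0 \<in> U \<and> (\<forall>g\<in>U. \<forall>k. \<bar>f (x + \<psi> k) - f (x + \<psi> (g + k))\<bar> \<le> \<epsilon>)"
    by blast
qed

lemma RUCB_translate:
  fixes f :: "'g::topological_group_add \<Rightarrow> real"
  assumes "f \<in> RUCB"
  shows "(\<lambda>x. f (g + x)) \<in> RUCB"
  by (rule RUCB_compose_endomorphism[OF assms, where \<psi> = "\<lambda>x. x"]) (simp_all add: endomorphism_def)

section \<open>Equivariant averaging operators\<close>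

text \<open>Operators with values in functions rather than numbers: an invariant mean is the case of
  constant values, the average over cosets is another, and both kinds compose. The last clause says
  that \<open>P\<close> commutes with left translations.\<close>

definition averaging :: "(('g::topological_group_add \<Rightarrow> real) \<Rightarrow> 'g \<Rightarrow> real) \<Rightarrow> bool" where
  "averaging P \<longleftrightarrow>
     (\<forall>f\<in>RUCB. \<forall>h\<in>RUCB. \<forall>x. P (\<lambda>y. f y + h y) x = P f x + P h x) \<and>
     (\<forall>c. \<forall>f\<in>RUCB. \<forall>x. P (\<lambda>y. c * f y) x = c * P f x) \<and>
     (\<forall>f\<in>RUCB. (\<forall>y. 0 \<le> f y) \<longrightarrow> (\<forall>x. 0 \<le> P f x)) \<and>
     (\<forall>x. P (\<lambda>y. 1) x = 1) \<and>
     (\<forall>f\<in>RUCB. \<forall>g x. P (\<lambda>y. f (g + y)) x = P f (g + x))"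

context
  fixes P :: "('g::topological_group_add \<Rightarrow> real) \<Rightarrow> 'g \<Rightarrow> real"
  assumes P: "averaging P"
begin

lemma averaging_add:
  "f \<in> RUCB \<Longrightarrow> h \<in> RUCB \<Longrightarrow> P (\<lambda>y. f y + h y) x = P f x + P h x"
  using P unfolding averaging_def by blast

lemma averaging_cmult: "f \<in> RUCB \<Longrightarrow> P (\<lambda>y. c * f y) x = c * P f x"
  using P unfolding averaging_def by blast

lemma averaging_nonneg: "f \<in> RUCB \<Longrightarrow> (\<And>y. 0 \<le> f y) \<Longrightarrow> 0 \<le> P f x"
  using P unfolding averaging_def by blast

lemma averaging_const: "P (\<lambda>y. c) x = c"
proof -
  have "P (\<lambda>y. 1) x = 1"
    using P unfolding averaging_def by blast
  then show ?thesis
    using averaging_cmult[OF RUCB_const, of c 1 x] by simp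
qed

lemma averaging_translate: "f \<in> RUCB \<Longrightarrow> P (\<lambda>y. f (g + y)) x = P f (g + x)"
  using P unfolding averaging_def by blast

lemma averaging_diff:
  assumes "f \<in> RUCB" "h \<in> RUCB"
  shows "P (\<lambda>y. f y - h y) x = P f x - P h x"
  using averaging_add[OF assms(1) RUCB_cmult[OF assms(2), of "-1"]] averaging_cmult[OF assms(2), of "-1"]
  by simp

lemma averaging_mono:
  assumes "f \<in> RUCB" "h \<in> RUCB" "\<And>y. f y \<le> h y"
  shows "P f x \<le> P h x"
  using averaging_nonneg[OF RUCB_diff[OF assms(2,1)]] assms by (simp add: averaging_diff)

text \<open>Positivity and preservation of constants make \<open>P\<close> a contraction for the
  supremum norm.\<close>

lemma averaging_abs_diff_le:
  assumes "f \<in> RUCB" "h \<in> RUCB" "\<And>y. \<bar>f y - h y\<bar> \<le> r"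
  shows "\<bar>P f x - P h x\<bar> \<le> r"
proof -
  have "P f x - P h x \<le> r"
    using averaging_mono[OF RUCB_diff[OF assms(1,2)] RUCB_const, of r x] assms(3)
    by (simp add: averaging_diff assms averaging_const abs_le_iff)
  moreover have "P h x - P f x \<le> r"
    using averaging_mono[OF RUCB_diff[OF assms(2,1)] RUCB_const, of r x] assms(3)
    by (simp add: averaging_diff assms averaging_const abs_le_iff)
  ultimately show ?thesis by linarith
qed

text \<open>A neighbourhood that works for \<open>f\<close> works for \<open>P f\<close>: the
  translate of \<open>P f\<close> by \<open>g\<close> is \<open>P\<close> of the translate of
  \<open>f\<close>, and \<open>P\<close> is a contraction.\<close>

lemma averaging_RUCB:
  assumes f: "f \<in> RUCB"
  shows "P f \<in> RUCB"
  unfolding RUCB_iff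
proof (intro conjI allI impI)
  obtain B where "\<And>x. \<bar>f x\<bar> \<le> B"
    using RUCB_bounded[OF f] by blast
  then have "\<bar>P f x\<bar> \<le> B" for x
    using averaging_abs_diff_le[OF f RUCB_const[of 0], of B x] by (simp add: averaging_const)
  then show "\<exists>B. \<forall>x. \<bar>P f x\<bar> \<le> B" by blast
next
  fix \<epsilon> :: real assume "\<epsilon> > 0"
  then obtain U where U: "open U" "0 \<in> U" "\<And>g y. g \<in> U \<Longrightarrow> \<bar>f y - f (g + y)\<bar> \<le> \<epsilon>"
    using RUCB_uniform[OF f] by blast
  have "\<bar>P f x - P f (g + x)\<bar> \<le> \<epsilon>" if "g \<in> U" for g x
    using averaging_abs_diff_le[OF f RUCB_translate[OF f, of g] U(3)[OF that]]
    by (simp add: averaging_translate[OF f])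
  then show "\<exists>U. open U \<and> 0 \<in> U \<and> (\<forall>g\<in>U. \<forall>x. \<bar>P f x - P f (g + x)\<bar> \<le> \<epsilon>)"
    using U by blast
qed

text \<open>
  Right invariance of \<open>d\<close> bounds how far a left translation moves any point, so Lipschitz
  continuity is a condition on left translates, which \<open>P\<close> respects.
\<close>

lemma averaging_Lipschitz:
  assumes d: "right_invariant d" and f: "f \<in> RUCB" "\<And>x y. \<bar>f x - f y\<bar> \<le> L * d x y"
  shows "\<bar>P f x - P f y\<bar> \<le> L * d x y"
proof -
  define g where "g = x - y"
  have x: "x = g + y" by (simp add: g_def)
  have "d (g + z) z = d x y" for z
    using d unfolding right_invariant_def x by (metis add_0)
  then have "\<bar>f (g + z) - f z\<bar> \<le> L * d x y" for z
    using f(2)[of "g + z" z] by simp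
  then have "\<bar>P (\<lambda>z. f (g + z)) y - P f y\<bar> \<le> L * d x y"
    by (intro averaging_abs_diff_le RUCB_translate f)
  then show ?thesis
    by (simp add: averaging_translate[OF f(1)] x)
qed

text \<open>The bias-variance identity, by expanding the square: the mean squared deviation from
  \<open>c\<close> is the variance plus the squared distance of the mean from
  \<open>c\<close>.\<close>

lemma averaging_variance_eq:
  assumes f: "f \<in> RUCB"
  shows "P (\<lambda>y. (f y - c)\<^sup>2) x = P (\<lambda>y. (f y)\<^sup>2) x - (P f x)\<^sup>2 + (P f x - c)\<^sup>2"
proof -
  have "P (\<lambda>y. (f y - c)\<^sup>2) x = P (\<lambda>y. ((f y)\<^sup>2 - (2 * c) * f y) + c\<^sup>2) x"
    by (simp add: power2_diff algebra_simps)
  also have "\<dots> = P (\<lambda>y. (f y)\<^sup>2) x - 2 * c * P f x + c\<^sup>2"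
    by (simp add: averaging_add averaging_diff averaging_cmult averaging_const RUCB_intros f)
  finally show ?thesis
    by (simp add: power2_eq_square algebra_simps)
qed

end

lemma averaging_ident: "averaging (\<lambda>f. f)"
  unfolding averaging_def by blast

lemma averaging_compose:
  assumes P: "averaging P" and Q: "averaging Q"
  shows "averaging (\<lambda>f. P (Q f))"
proof -
  have "P (Q (\<lambda>y. f y + h y)) x = P (Q f) x + P (Q h) x" if "f \<in> RUCB" "h \<in> RUCB" for f h x
    using averaging_add[OF P averaging_RUCB[OF Q that(1)] averaging_RUCB[OF Q that(2)], of x]
      averaging_add[OF Q that] by presburger
  moreover have "P (Q (\<lambda>y. c * f y)) x = c * P (Q f) x" if "f \<in> RUCB" for f c x
    using averaging_cmult[OF P averaging_RUCB[OF Q that], of c x]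
      averaging_cmult[OF Q that] by presburger
  moreover have "P (Q (\<lambda>y. f (g + y))) x = P (Q f) (g + x)" if "f \<in> RUCB" for f g x
    using averaging_translate[OF P averaging_RUCB[OF Q that], of g x]
      averaging_translate[OF Q that] by presburger
  moreover have "P (Q (\<lambda>y. 1)) x = 1" for x
    using averaging_const[OF Q] averaging_const[OF P] by presburger
  ultimately show ?thesis
    unfolding averaging_def
    using averaging_nonneg[OF P averaging_RUCB[OF Q]] averaging_nonneg[OF Q] by blast
qed

section \<open>Invariant means as averaging operators, and averages over images of
  endomorphisms\<close>

lemma averaging_mean:
  assumes "invariant_mean \<mu>"
  shows "averaging (\<lambda>f x. \<mu> f)"
  using assms unfolding averaging_def invariant_mean_def comp_def by blast

text \<open>If \<open>P f\<close> is constant, commuting with left translations becomes left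
  invariance of its value, which is read off at 0.\<close>

lemma invariant_mean_averaging:
  assumes P: "averaging P" and const: "\<And>f x. f \<in> RUCB \<Longrightarrow> P f x = P f 0"
  shows "invariant_mean (\<lambda>f. P f 0)"
  unfolding invariant_mean_def comp_def
proof (intro conjI ballI allI impI)
  show "P (\<lambda>x. f (g + x)) 0 = P f 0" if "f \<in> RUCB" for f g
    using averaging_translate[OF P that, of g 0] const[OF that, of "g + 0"] by (rule trans)
qed (simp_all only: averaging_add[OF P] averaging_cmult[OF P] averaging_nonneg[OF P] averaging_const[OF P])

text \<open>The average of \<open>f\<close> over the left coset of the image of
  \<open>\<psi>\<close> through \<open>x\<close>, with respect to the push-forward of
  \<open>\<mu>\<close> along \<open>\<psi>\<close>.\<close>

definition average ::
    "(('g::topological_group_add \<Rightarrow> real) \<Rightarrow> real) \<Rightarrow> ('g \<Rightarrow> 'g) \<Rightarrow> ('g \<Rightarrow> real) \<Rightarrow> 'g \<Rightarrow> real" where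
  "average \<mu> \<psi> f = (\<lambda>x. \<mu> (\<lambda>k. f (x + \<psi> k)))"

lemma averaging_average:
  assumes \<mu>: "invariant_mean \<mu>" and \<psi>: "endomorphism \<psi>" "continuous_on UNIV \<psi>"
  shows "averaging (average \<mu> \<psi>)"
  unfolding averaging_def average_def
proof (intro conjI ballI allI impI)
  note mean = averaging_mean[OF \<mu>] and R = RUCB_compose_endomorphism[OF _ \<psi>]
  fix f h :: "'a \<Rightarrow> real" and c x g
  assume f: "f \<in> RUCB"
  show "\<mu> (\<lambda>k. f (x + \<psi> k) + h (x + \<psi> k)) = \<mu> (\<lambda>k. f (x + \<psi> k)) + \<mu> (\<lambda>k. h (x + \<psi> k))"
    if "h \<in> RUCB"
    by (rule averaging_add[OF mean R[OF f] R[OF that]])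
  show "\<mu> (\<lambda>k. c * f (x + \<psi> k)) = c * \<mu> (\<lambda>k. f (x + \<psi> k))"
    by (rule averaging_cmult[OF mean R[OF f]])
  show "0 \<le> \<mu> (\<lambda>k. f (x + \<psi> k))" if "\<forall>y. 0 \<le> f y"
    using that by (intro averaging_nonneg[OF mean R[OF f]]) blast
  show "\<mu> (\<lambda>k. f (g + (x + \<psi> k))) = \<mu> (\<lambda>k. f (g + x + \<psi> k))"
    by (simp only: add.assoc)
qed (rule averaging_const[OF averaging_mean[OF \<mu>]])

text \<open>Since \<open>\<psi>\<close> is a homomorphism, the extra summand \<open>\<psi> h\<close>
  amounts to a left translation of the averaging variable, which \<open>\<mu>\<close> does not
  see.\<close>

lemma average_right_invariant:
  assumes \<mu>: "invariant_mean \<mu>" and \<psi>: "endomorphism \<psi>" "continuous_on UNIV \<psi>" and f: "f \<in> RUCB"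
  shows "average \<mu> \<psi> f (x + \<psi> h) = average \<mu> \<psi> f x"
proof -
  have "average \<mu> \<psi> f (x + \<psi> h) = \<mu> (\<lambda>k. f (x + \<psi> (h + k)))"
    using \<psi>(1) by (simp add: average_def endomorphism_def add.assoc)
  also have "\<dots> = average \<mu> \<psi> f x"
    using averaging_translate[OF averaging_mean[OF \<mu>] RUCB_compose_endomorphism[OF f \<psi>]]
    by (simp add: average_def)
  finally show ?thesis .
qed

text \<open>The variance is at most the mean squared deviation from any constant. The constant taken
  is \<open>f x\<close>, from which \<open>f\<close> deviates by at most \<open>r\<close> along the
  coset of \<open>x\<close>.\<close>

lemma average_variance_le:
  assumes \<mu>: "invariant_mean \<mu>" and \<psi>: "endomorphism \<psi>" "continuous_on UNIV \<psi>" and f: "f \<in> RUCB"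
    and r: "\<And>k. \<bar>f (x + \<psi> k) - f x\<bar> \<le> r"
  shows "average \<mu> \<psi> (\<lambda>y. (f y)\<^sup>2) x \<le> (average \<mu> \<psi> f x)\<^sup>2 + r\<^sup>2"
proof -
  note mean = averaging_mean[OF \<mu>]
  have "(f (x + \<psi> k) - f x)\<^sup>2 \<le> r\<^sup>2" for k
    using r[of k] by (simp add: abs_le_square_iff[symmetric])
  then have "average \<mu> \<psi> (\<lambda>y. (f y - f x)\<^sup>2) x \<le> r\<^sup>2"
    unfolding average_def
    using averaging_mono[OF mean RUCB_compose_endomorphism[OF _ \<psi>, of "\<lambda>y. (f y - f x)\<^sup>2" x] RUCB_const[of "r\<^sup>2"]]
    by (simp add: averaging_const[OF mean] RUCB_intros f)
  then show ?thesis
    using averaging_variance_eq[OF averaging_average[OF \<mu> \<psi>] f, of "f x" x]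
      zero_le_power2[of "average \<mu> \<psi> f x - f x"] by linarith
qed

section \<open>Concentration along a chain\<close>

primrec chain_average ::
    "(('g::topological_group_add \<Rightarrow> real) \<Rightarrow> real) \<Rightarrow> (nat \<Rightarrow> 'g \<Rightarrow> 'g) \<Rightarrow> nat \<Rightarrow>
     ('g \<Rightarrow> real) \<Rightarrow> 'g \<Rightarrow> real" where
  "chain_average \<mu> \<psi> 0 f = f"
| "chain_average \<mu> \<psi> (Suc i) f = average \<mu> (\<psi> (Suc i)) (chain_average \<mu> \<psi> i f)"

context
  fixes \<mu> :: "('g::topological_group_add \<Rightarrow> real) \<Rightarrow> real" and \<psi> :: "nat \<Rightarrow> 'g \<Rightarrow> 'g" and n :: nat
  assumes \<mu>: "invariant_mean \<mu>"
    and endo: "\<And>i. i \<le> n \<Longrightarrow> endomorphism (\<psi> i)"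
    and cont: "\<And>i. i \<le> n \<Longrightarrow> continuous_on UNIV (\<psi> i)"
    and triv: "\<And>x. \<psi> 0 x = 0"
begin

lemma averaging_chain: "i \<le> n \<Longrightarrow> averaging (chain_average \<mu> \<psi> i)"
proof (induction i)
  case 0
  have "chain_average \<mu> \<psi> 0 = (\<lambda>f. f)" by (intro ext) simp
  then show ?case by (simp only: averaging_ident)
next
  case (Suc i)
  have "chain_average \<mu> \<psi> (Suc i) = (\<lambda>f. average \<mu> (\<psi> (Suc i)) (chain_average \<mu> \<psi> i f))"
    by (intro ext) simp
  moreover have "averaging \<dots>"
    using Suc by (intro averaging_compose[OF averaging_average[OF \<mu> endo cont]]) auto
  ultimately show ?case by (simp only:)
qed

text \<open>For positive \<open>i\<close> the outermost average gives the invariance. For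
  \<open>i = 0\<close> no average has been taken, but \<open>\<psi> 0\<close> is trivial.\<close>

lemma chain_average_right_invariant:
  assumes "i \<le> n" "f \<in> RUCB"
  shows "chain_average \<mu> \<psi> i f (x + \<psi> i h) = chain_average \<mu> \<psi> i f x"
proof (cases i)
  case 0
  then show ?thesis by (simp add: triv)
next
  case (Suc j)
  then have j: "Suc j \<le> n" "j \<le> n" using assms by auto
  show ?thesis
    unfolding Suc chain_average.simps
    by (rule average_right_invariant[OF \<mu> endo[OF j(1)] cont[OF j(1)]
          averaging_RUCB[OF averaging_chain[OF j(2)] assms(2)]])
qed

text \<open>A law of total variance: each further average adds only the variance within one coset,
  which is at most \<open>(L * r)\<^sup>2\<close>.\<close>

lemma chain_average_variance_le:
  assumes d: "right_invariant d" and f: "f \<in> RUCB" "\<And>x y. \<bar>f x - f y\<bar> \<le> L * d x y" and "L \<ge> 0"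
    and r: "\<And>j g h. j < n \<Longrightarrow> d (g + \<psi> (Suc j) h) (g + \<psi> j h) \<le> r"
    and "i \<le> n"
  shows "chain_average \<mu> \<psi> i (\<lambda>y. (f y)\<^sup>2) x \<le> (chain_average \<mu> \<psi> i f x)\<^sup>2 + real i * (L * r)\<^sup>2"
  using \<open>i \<le> n\<close>
proof (induction i arbitrary: x)
  case 0
  then show ?case by simp
next
  case (Suc i)
  define F where "F = chain_average \<mu> \<psi> i f"
  define E where "E = average \<mu> (\<psi> (Suc i))"
  have E: "averaging E"
    unfolding E_def using Suc by (intro averaging_average \<mu> endo cont) auto
  have chain: "averaging (chain_average \<mu> \<psi> i)"
    using Suc averaging_chain by simp
  have F: "F \<in> RUCB"
    unfolding F_def by (intro averaging_RUCB[OF chain] f)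
  \<comment> \<open>By invariance under \<open>\<psi> i\<close>, the point \<open>x\<close> may be
    replaced by \<open>x + \<psi> i k\<close>, which is within \<open>r\<close> of
    \<open>x + \<psi> (Suc i) k\<close>. Averaging has not increased the Lipschitz constant
    \<open>L\<close>.\<close>
  have osc: "\<bar>F (x + \<psi> (Suc i) k) - F x\<bar> \<le> L * r" for k
  proof -
    have "F x = F (x + \<psi> i k)"
      unfolding F_def using Suc by (simp add: chain_average_right_invariant f)
    also have "\<bar>F (x + \<psi> (Suc i) k) - \<dots>\<bar> \<le> L * d (x + \<psi> (Suc i) k) (x + \<psi> i k)"
      unfolding F_def by (intro averaging_Lipschitz[OF chain d] f)
    also have "\<dots> \<le> L * r"
      using r[of i] Suc \<open>L \<ge> 0\<close> by (intro mult_left_mono) auto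
    finally show ?thesis .
  qed
  \<comment> \<open>The induction hypothesis holds at every point, so \<open>E\<close> can be
    applied to both sides; the error accumulated so far is a constant and passes through
    \<open>E\<close> unchanged.\<close>
  have "E (chain_average \<mu> \<psi> i (\<lambda>y. (f y)\<^sup>2)) x \<le> E (\<lambda>x. (F x)\<^sup>2 + real i * (L * r)\<^sup>2) x"
    using Suc unfolding F_def
    by (intro averaging_mono[OF E] averaging_RUCB[OF chain] RUCB_intros f) auto
  also have "\<dots> = E (\<lambda>x. (F x)\<^sup>2) x + real i * (L * r)\<^sup>2"
    by (simp add: averaging_add[OF E] averaging_const[OF E] RUCB_intros F)
  also have "E (\<lambda>x. (F x)\<^sup>2) x \<le> (E F x)\<^sup>2 + (L * r)\<^sup>2"
    unfolding E_def using Suc by (intro average_variance_le \<mu> endo cont F osc) auto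
  finally show ?case
    by (simp add: E_def F_def algebra_simps)
qed

end

section \<open>Chains of parameters in \<open>D\<close> and the concentrated mean\<close>

lemma uniform_chain:
  fixes D :: "real set"
  assumes "{0..1} \<subseteq> closure D" "{0, 1} \<subseteq> D" "n > 0"
  obtains t :: "nat \<Rightarrow> real" where
    "\<And>i. i \<le> n \<Longrightarrow> t i \<in> D" "t 0 = 0" "t n = 1" "\<And>i. i < n \<Longrightarrow> \<bar>t (Suc i) - t i\<bar> \<le> 3 / real n"
proof -
  \<comment> \<open>The endpoints are met exactly because the chain has to start at the trivial
    endomorphism and end at the surjective one. Between them, two approximation errors and one grid
    step make up the \<open>3 / real n\<close>.\<close>
  have "\<exists>s. i \<le> n \<longrightarrow> s \<in> D \<and> \<bar>s - real i / real n\<bar> \<le> 1 / real n \<and> (i = 0 \<longrightarrow> s = 0) \<and> (i = n \<longrightarrow> s = 1)"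
    for i
  proof -
    consider "i = 0" | "i = n" | "0 < i" "i < n" | "i > n" by linarith
    then show ?thesis
    proof cases
      case 1
      then show ?thesis using assms by (intro exI[of _ 0]) auto
    next
      case 2
      then show ?thesis using assms by (intro exI[of _ 1]) auto
    next
      case 3
      then have "real i / real n \<in> closure D"
        using assms(1) by (auto simp: divide_simps)
      then obtain s where "s \<in> D" "dist s (real i / real n) < 1 / real n"
        using \<open>n > 0\<close> by (metis closure_approachable of_nat_0_less_iff zero_less_divide_1_iff)
      then show ?thesis
        using 3 by (intro exI[of _ s]) (auto simp: dist_real_def)
    next
      case 4
      then show ?thesis by simp
    qed
  qed
  then obtain t where t: "\<And>i. i \<le> n \<Longrightarrow> t i \<in> D \<and> \<bar>t i - real i / real n\<bar> \<le> 1 / real n \<and>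
      (i = 0 \<longrightarrow> t i = 0) \<and> (i = n \<longrightarrow> t i = 1)"
    by metis
  have "\<bar>t (Suc i) - t i\<bar> \<le> 3 / real n" if "i < n" for i
  proof -
    have "\<bar>t (Suc i) - real (Suc i) / real n\<bar> \<le> 1 / real n" "\<bar>t i - real i / real n\<bar> \<le> 1 / real n"
      using t[of "Suc i"] t[of i] that by auto
    moreover have "real (Suc i) / real n = real i / real n + 1 / real n"
      by (simp add: add_divide_distrib)
    ultimately have "\<bar>t (Suc i) - t i\<bar> \<le> 3 * (1 / real n)"
      by linarith
    then show ?thesis by simp
  qed
  then show thesis
    using t by (intro that[of t]) auto
qed

text \<open>The total error \<open>n * (3 * C * L / n)\<^sup>2\<close> scales with the square of
  \<open>L\<close>, so the chain length can be fixed before \<open>f\<close> and \<open>L\<close>,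
  and a single mean serves all Lipschitz functions.\<close>

lemma exists_concentrated_mean:
  fixes d :: "'g::topological_group_add \<Rightarrow> 'g \<Rightarrow> real"
  assumes d: "right_invariant d"
    and D: "{0..1} \<subseteq> closure D" "{0, 1} \<subseteq> D"
    and endo: "\<And>t. t \<in> D \<Longrightarrow> endomorphism (\<phi> t)"
    and cont: "\<And>t. t \<in> D \<Longrightarrow> continuous_on UNIV (\<phi> t)"
    and triv: "range (\<phi> 0) = {0}" and surj: "range (\<phi> 1) = UNIV"
    and C: "C \<ge> 0" "\<And>s t g h. s \<in> D \<Longrightarrow> t \<in> D \<Longrightarrow> d (g + \<phi> s h) (g + \<phi> t h) \<le> C * \<bar>s - t\<bar>"
    and amenable: "amenable TYPE('g)"
    and "\<epsilon> > 0"
  obtains \<nu> where "invariant_mean \<nu>"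
    "\<And>f L. f \<in> RUCB \<Longrightarrow> L \<ge> 0 \<Longrightarrow> (\<And>x y. \<bar>f x - f y\<bar> \<le> L * d x y) \<Longrightarrow>
       \<nu> (\<lambda>x. (f x)\<^sup>2) \<le> (\<nu> f)\<^sup>2 + \<epsilon> * L\<^sup>2"
proof -
  obtain \<mu> :: "('g \<Rightarrow> real) \<Rightarrow> real" where \<mu>: "invariant_mean \<mu>"
    using amenable unfolding amenable_def by blast
  obtain n :: nat where n: "real n > 9 * C\<^sup>2 / \<epsilon>"
    using reals_Archimedean2 by blast
  moreover have "9 * C\<^sup>2 / \<epsilon> \<ge> 0"
    using \<open>\<epsilon> > 0\<close> by simp
  ultimately have "n > 0"
    by (metis not_less of_nat_0_less_iff le_less_trans)
  obtain t where t: "\<And>i. i \<le> n \<Longrightarrow> t i \<in> D" "t 0 = 0" "t n = 1"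
    "\<And>i. i < n \<Longrightarrow> \<bar>t (Suc i) - t i\<bar> \<le> 3 / real n"
    using uniform_chain[OF D \<open>n > 0\<close>] by blast
  define \<psi> where "\<psi> i = \<phi> (t i)" for i
  define r where "r = C * (3 / real n)"
  have \<psi>: "endomorphism (\<psi> i)" "continuous_on UNIV (\<psi> i)" if "i \<le> n" for i
    using endo cont t(1) that by (auto simp: \<psi>_def)
  have \<psi>0: "\<psi> 0 x = 0" for x
    using triv by (auto simp: \<psi>_def t(2))
  have step: "d (g + \<psi> (Suc i) h) (g + \<psi> i h) \<le> r" if "i < n" for i g h
  proof -
    have "d (g + \<psi> (Suc i) h) (g + \<psi> i h) \<le> C * \<bar>t (Suc i) - t i\<bar>"
      unfolding \<psi>_def using that by (intro C t(1)) auto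
    also have "\<dots> \<le> r"
      unfolding r_def using that by (intro mult_left_mono t(4) C(1))
    finally show ?thesis .
  qed
  have P: "averaging (chain_average \<mu> \<psi> n)"
    using averaging_chain[of \<mu> n \<psi> n] \<mu> \<psi> \<psi>0 by blast
  define \<nu> where "\<nu> f = chain_average \<mu> \<psi> n f 0" for f
  \<comment> \<open>The last map of the chain is \<open>\<phi> 1\<close>; as it is onto, right
    invariance under its image forces constancy.\<close>
  have "chain_average \<mu> \<psi> n f x = chain_average \<mu> \<psi> n f 0" if "f \<in> RUCB" for f x
  proof -
    obtain h where "x = \<psi> n h"
      using surj unfolding \<psi>_def t(3) by (metis UNIV_I imageE)
    then show ?thesis
      using chain_average_right_invariant[of \<mu> n \<psi> n f 0 h] \<mu> \<psi> \<psi>0 that by simp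
  qed
  then have "invariant_mean \<nu>"
    using invariant_mean_averaging[OF P] unfolding \<nu>_def by blast
  moreover have "\<nu> (\<lambda>x. (f x)\<^sup>2) \<le> (\<nu> f)\<^sup>2 + \<epsilon> * L\<^sup>2"
    if f: "f \<in> RUCB" "L \<ge> 0" "\<And>x y. \<bar>f x - f y\<bar> \<le> L * d x y" for f L
  proof -
    have "\<nu> (\<lambda>x. (f x)\<^sup>2) \<le> (\<nu> f)\<^sup>2 + real n * (L * r)\<^sup>2"
      unfolding \<nu>_def
      using chain_average_variance_le[OF \<mu> \<psi> \<psi>0 d f(1) f(3) f(2) step, where i = n and n = n] by blast
    moreover have "real n * (L * r)\<^sup>2 \<le> \<epsilon> * L\<^sup>2"
    proof -
      have "9 * C\<^sup>2 / real n \<le> \<epsilon>"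
        using n \<open>n > 0\<close> \<open>\<epsilon> > 0\<close> by (simp add: field_simps)
      moreover have "real n * (L * r)\<^sup>2 = 9 * C\<^sup>2 / real n * L\<^sup>2"
        using \<open>n > 0\<close> by (simp add: r_def power2_eq_square)
      ultimately show ?thesis
        by (metis mult_right_mono zero_le_power2)
    qed
    ultimately show ?thesis by linarith
  qed
  ultimately show thesis
    by (rule that)
qed

section \<open>Lipschitz approximation\<close>

text \<open>The approximant is the infimal convolution of \<open>f\<close> with a large multiple of the metric.\<close>

lemma RUCB_Lipschitz_approximation:
  fixes d :: "'g::topological_group_add \<Rightarrow> 'g \<Rightarrow> real"
  assumes "Metric_space UNIV d" and top: "Metric_space.mtopology UNIV d = euclidean"
    and d: "right_invariant d" and f: "f \<in> RUCB" and "\<epsilon> > 0"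
  obtains h L where "h \<in> RUCB" "L \<ge> 0" "\<And>x y. \<bar>h x - h y\<bar> \<le> L * d x y" "\<And>x. \<bar>f x - h x\<bar> \<le> \<epsilon>"
proof -
  interpret Metric_space UNIV d by fact
  obtain B where B: "B > 0" "\<And>x. \<bar>f x\<bar> \<le> B"
    using RUCB_bounded[OF f] by blast
  obtain U where U: "open U" "0 \<in> U" "\<And>g x. g \<in> U \<Longrightarrow> \<bar>f x - f (g + x)\<bar> \<le> \<epsilon>"
    using RUCB_uniform[OF f \<open>\<epsilon> > 0\<close>] by blast
  have "openin mtopology U"
    using U(1) by (simp add: top)
  then obtain \<delta> where \<delta>: "\<delta> > 0" "mball 0 \<delta> \<subseteq> U"
    using U(2) unfolding openin_mtopology by blast
  \<comment> \<open>With this slope the penalty \<open>L * d x y\<close> at distance at least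
    \<open>\<delta>\<close> is at least \<open>2 * B\<close>, the largest possible oscillation of
    \<open>f\<close>. So only points closer than \<open>\<delta>\<close> can bring the infimum
    down.\<close>
  define L where "L = 2 * B / \<delta>"
  have L: "L > 0" "L * \<delta> = 2 * B"
    using B(1) \<delta>(1) by (auto simp: L_def)
  define h where "h x = (INF y. f y + L * d x y)" for x
  have below: "- B \<le> f y + L * d x y" for x y
    using B(2)[of y] L(1) by (smt (verit) mult_nonneg_nonneg nonneg)
  have bdd: "bdd_below (range (\<lambda>y. f y + L * d x y))" for x
    using below by (intro bdd_belowI[of _ "- B"]) auto
  have h_le: "h x \<le> f y + L * d x y" for x y
    unfolding h_def by (intro cINF_lower bdd) simp
  have h_ge: "a \<le> h x" if "\<And>y. a \<le> f y + L * d x y" for a x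
    unfolding h_def using that by (intro cINF_greatest) auto
  have h_diff: "h x \<le> h y + L * d x y" for x y
  proof -
    have "h x - L * d x y \<le> f z + L * d y z" for z
    proof -
      have "L * d x z \<le> L * d x y + L * d y z"
        using triangle[of x y z] L(1) by (simp flip: distrib_left)
      then show ?thesis using h_le[of x z] by linarith
    qed
    then have "h x - L * d x y \<le> h y" by (rule h_ge)
    then show ?thesis by linarith
  qed
  have Lip: "\<bar>h x - h y\<bar> \<le> L * d x y" for x y
    using h_diff[of x y] h_diff[of y x] commute[of x y] by simp
  have close: "\<bar>f x - h x\<bar> \<le> \<epsilon>" for x
  proof -
    have "h x \<le> f x"
      using h_le[of x x] by simp
    moreover have "f x - \<epsilon> \<le> f y + L * d x y" for y
    proof (cases "d x y < \<delta>")
      case True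
      \<comment> \<open>Right invariance turns closeness of \<open>y\<close> to \<open>x\<close>
        into smallness of the left translation by \<open>y - x\<close>, the form in which
        \<open>RUCB\<close> controls \<open>f\<close>.\<close>
      have "d 0 (y - x) = d (0 + x) ((y - x) + x)"
        using d unfolding right_invariant_def by metis
      then have "y - x \<in> U"
        using True \<delta>(2) by auto
      then have "\<bar>f x - f y\<bar> \<le> \<epsilon>"
        using U(3)[of "y - x" x] by simp
      then show ?thesis
        using L(1) mult_nonneg_nonneg[of L "d x y"] nonneg[of x y] by linarith
    next
      case False
      then have "2 * B \<le> L * d x y"
        using L mult_left_mono[of \<delta> "d x y" L] by simp
      then show ?thesis
        using B(2)[of x] B(2)[of y] \<open>\<epsilon> > 0\<close> by linarith
    qed
    then have "f x - \<epsilon> \<le> h x" by (rule h_ge)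
    ultimately show ?thesis using \<open>\<epsilon> > 0\<close> by linarith
  qed
  have "h \<in> RUCB"
    unfolding RUCB_iff
  proof (intro conjI allI impI)
    have "\<bar>h x\<bar> \<le> B + \<epsilon>" for x
      using close[of x] B(2)[of x] by linarith
    then show "\<exists>B. \<forall>x. \<bar>h x\<bar> \<le> B" by blast
  next
    fix \<eta> :: real assume "\<eta> > 0"
    have "\<bar>h x - h (g + x)\<bar> \<le> \<eta>" if "g \<in> mball 0 (\<eta> / L)" for g x
    proof -
      have "d (0 + x) (g + x) = d 0 g"
        using d unfolding right_invariant_def by blast
      then have "L * d x (g + x) \<le> \<eta>"
        using that L(1) by (simp add: field_simps)
      then show ?thesis
        using Lip[of x "g + x"] by linarith
    qed
    moreover have "open (mball 0 (\<eta> / L))"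
      using openin_mball[of 0 "\<eta> / L"] unfolding top by simp
    moreover have "0 \<in> mball 0 (\<eta> / L)"
      using L(1) \<open>\<eta> > 0\<close> by simp
    ultimately show "\<exists>U. open U \<and> 0 \<in> U \<and> (\<forall>g\<in>U. \<forall>x. \<bar>h x - h (g + x)\<bar> \<le> \<eta>)"
      by blast
  qed
  then show thesis
    using L(1) Lip close by (intro that[of h L]) auto
qed

section \<open>Almost invariant points\<close>

lemma square_sum_le: "(a + b)\<^sup>2 \<le> 2 * a\<^sup>2 + 2 * b\<^sup>2" for a b :: real
  using zero_le_power2[of "a - b"] by (simp add: power2_sum power2_diff)

lemma averaging_sum:
  assumes P: "averaging P" and "\<And>i. i \<in> I \<Longrightarrow> f i \<in> RUCB"
  shows "P (\<lambda>y. \<Sum>i\<in>I. f i y) x = (\<Sum>i\<in>I. P (f i) x)"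
  using assms(2)
proof (induction I rule: infinite_finite_induct)
  case (insert i I)
  then have "P (\<lambda>y. f i y + (\<Sum>i\<in>I. f i y)) x = P (f i) x + P (\<lambda>y. \<Sum>i\<in>I. f i y) x"
    by (intro averaging_add[OF P] RUCB_sum) auto
  then show ?case
    using insert by simp
qed (simp_all add: averaging_const[OF P])

text \<open>Under \<open>\<nu>\<close> each \<open>f\<close> is close in mean square to a constant,
  and by invariance so are its translates. Hence the sum of all squared displacements has mean below
  \<open>\<epsilon>\<^sup>2\<close> and falls below \<open>\<epsilon>\<^sup>2\<close> at some
  point.\<close>

lemma exists_almost_invariant_point:
  fixes J :: "(('g::topological_group_add \<Rightarrow> real) \<times> 'g) set"
  assumes conc: "\<And>(F :: ('g \<Rightarrow> real) set) \<epsilon>. finite F \<Longrightarrow> F \<subseteq> RUCB \<Longrightarrow> \<epsilon> > 0 \<Longrightarrow>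
      \<exists>\<nu>. invariant_mean \<nu> \<and> (\<forall>f\<in>F. \<exists>c. \<nu> (\<lambda>x. (f x - c)\<^sup>2) \<le> \<epsilon>)"
    and J: "finite J" "fst ` J \<subseteq> RUCB" and "\<epsilon> > 0"
  obtains x where "\<And>f g. (f, g) \<in> J \<Longrightarrow> \<bar>f (g + x) - f x\<bar> \<le> \<epsilon>"
proof -
  \<comment> \<open>Each squared displacement will have mean at most \<open>4 * \<delta>\<close>.
    The added 1 keeps the total strictly below \<open>\<epsilon>\<^sup>2\<close> and covers empty
    \<open>J\<close>.\<close>
  define \<delta> where "\<delta> = \<epsilon>\<^sup>2 / (4 * (real (card J) + 1))"
  have "\<delta> > 0" using \<open>\<epsilon> > 0\<close> by (simp add: \<delta>_def)
  have "real (card J) * (4 * \<delta>) = \<epsilon>\<^sup>2 * (real (card J) / (real (card J) + 1))"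
    unfolding \<delta>_def by (simp add: divide_simps)
  also have "\<dots> < \<epsilon>\<^sup>2 * 1"
    using \<open>\<epsilon> > 0\<close> by (intro mult_strict_left_mono) auto
  finally have \<delta>: "real (card J) * (4 * \<delta>) < \<epsilon>\<^sup>2" by simp
  obtain \<nu> where \<nu>: "invariant_mean \<nu>" "\<forall>f\<in>fst ` J. \<exists>c. \<nu> (\<lambda>x. (f x - c)\<^sup>2) \<le> \<delta>"
    using conc[of "fst ` J" \<delta>] J \<open>\<delta> > 0\<close> by auto
  note mean = averaging_mean[OF \<nu>(1)]
  define q where "q = (\<lambda>(f, g :: 'g) x. (f (g + x) - f x :: real)\<^sup>2)"
  have q_RUCB: "q j \<in> RUCB" if "j \<in> J" for j
    using that J(2) unfolding q_def by (cases j) (auto intro!: RUCB_square RUCB_diff RUCB_translate)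
  have q_le: "\<nu> (q j) \<le> 4 * \<delta>" if "j \<in> J" for j
  proof -
    obtain f g where j: "j = (f, g)" by (cases j)
    then have "f \<in> fst ` J" using that by force
    then have f: "f \<in> RUCB" using J(2) by blast
    obtain c where c: "\<nu> (\<lambda>x. (f x - c)\<^sup>2) \<le> \<delta>"
      using \<nu>(2) \<open>f \<in> fst ` J\<close> by blast
    define u where "u = (\<lambda>x. (f x - c)\<^sup>2)"
    have u: "u \<in> RUCB" unfolding u_def by (intro RUCB_intros f)
    have "q j y \<le> 2 * u (g + y) + 2 * u y" for y
      using square_sum_le[of "f (g + y) - c" "c - f y"]
      by (simp add: q_def j u_def power2_commute[of c])
    then have "\<nu> (q j) \<le> \<nu> (\<lambda>y. 2 * u (g + y) + 2 * u y)"
      by (intro averaging_mono[OF mean] q_RUCB that RUCB_add RUCB_cmult RUCB_translate u)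
    also have "\<dots> = \<nu> (\<lambda>y. 2 * u (g + y)) + \<nu> (\<lambda>y. 2 * u y)"
      by (intro averaging_add[OF mean] RUCB_cmult RUCB_translate u)
    also have "\<nu> (\<lambda>y. 2 * u (g + y)) = 2 * \<nu> (\<lambda>y. u (g + y))"
      by (intro averaging_cmult[OF mean] RUCB_translate u)
    also have "\<nu> (\<lambda>y. u (g + y)) = \<nu> u"
      by (intro averaging_translate[OF mean] u)
    also have "\<nu> (\<lambda>y. 2 * u y) = 2 * \<nu> u"
      by (intro averaging_cmult[OF mean] u)
    finally show ?thesis using c by (simp add: u_def)
  qed
  have "\<exists>x. (\<Sum>j\<in>J. q j x) < \<epsilon>\<^sup>2"
  proof (rule ccontr)
    assume "\<nexists>x. (\<Sum>j\<in>J. q j x) < \<epsilon>\<^sup>2"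
    then have "\<epsilon>\<^sup>2 \<le> (\<Sum>j\<in>J. q j x)" for x
      by (simp add: not_less)
    then have "\<epsilon>\<^sup>2 \<le> \<nu> (\<lambda>x. \<Sum>j\<in>J. q j x)"
      using averaging_mono[OF mean RUCB_const[of "\<epsilon>\<^sup>2"] RUCB_sum[where I = J and f = q]] q_RUCB
      by (simp add: averaging_const[OF mean])
    also have "\<dots> = (\<Sum>j\<in>J. \<nu> (q j))"
      by (intro averaging_sum[OF mean] q_RUCB)
    also have "\<dots> \<le> real (card J) * (4 * \<delta>)"
      by (intro sum_bounded_above q_le)
    finally show False using \<delta> by simp
  qed
  then obtain x where x: "(\<Sum>j\<in>J. q j x) < \<epsilon>\<^sup>2" by blast
  have "\<bar>f (g + x) - f x\<bar> \<le> \<epsilon>" if "(f, g) \<in> J" for f g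
  proof -
    have "q (f, g) x \<le> (\<Sum>j\<in>J. q j x)"
      using that J(1) by (intro member_le_sum) (auto simp: q_def)
    then have "(f (g + x) - f x)\<^sup>2 \<le> \<epsilon>\<^sup>2"
      using x by (simp add: q_def)
    then show ?thesis
      using \<open>\<epsilon> > 0\<close> by (metis abs_le_square_iff abs_of_pos)
  qed
  then show thesis by (rule that)
qed

section \<open>From almost invariant points to fixed points\<close>

text \<open>The displacement of \<open>p\<close> under \<open>g\<close> vanishes for
  \<open>g = 0\<close> on all of \<open>X\<close>. By joint continuity and compactness, the tube
  lemma keeps it below \<open>\<epsilon>\<close> on \<open>U \<times> X\<close> for some
  neighbourhood \<open>U\<close> of 0, hence uniformly along the orbit.\<close>

lemma orbit_function_RUCB:
  fixes act :: "'g::topological_group_add \<Rightarrow> 'x \<Rightarrow> 'x"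
  assumes X: "compact_space X" and act: "continuous_action X act" and x: "x \<in> topspace X"
    and p: "continuous_map X euclideanreal p"
  shows "(\<lambda>g. p (act g x)) \<in> RUCB"
proof -
  have act_cont: "continuous_map (prod_topology euclidean X) X (\<lambda>(g, x). act g x)"
    and act_zero: "\<And>y. y \<in> topspace X \<Longrightarrow> act 0 y = y"
    and act_add: "\<And>g h y. y \<in> topspace X \<Longrightarrow> act (g + h) y = act g (act h y)"
    using act unfolding continuous_action_def by blast+
  have in_X: "act g y \<in> topspace X" if "y \<in> topspace X" for g y
    using continuous_map_funspace[OF act_cont] that by (auto simp: Pi_iff)
  have "compactin euclideanreal (p ` topspace X)"
    using X p by (metis compact_space_def image_compactin)
  then have "bounded (p ` topspace X)"
    by (simp add: compact_imp_bounded)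
  then obtain B where B: "\<And>y. y \<in> topspace X \<Longrightarrow> \<bar>p y\<bar> \<le> B"
    by (auto simp: bounded_iff)
  have pact: "continuous_map (prod_topology euclidean X) euclideanreal (\<lambda>z. p (case z of (g, y) \<Rightarrow> act g y))"
    using continuous_map_compose[OF act_cont p] by (simp add: comp_def)
  have psnd: "continuous_map (prod_topology (euclidean :: 'g topology) X) euclideanreal (\<lambda>z. p (snd z))"
    using continuous_map_compose[OF continuous_map_snd p] by (simp add: comp_def)
  show ?thesis
    unfolding RUCB_iff
  proof (intro conjI allI impI)
    show "\<exists>B. \<forall>g. \<bar>p (act g x)\<bar> \<le> B"
      using B in_X[OF x] by blast
  next
    fix \<epsilon> :: real assume "\<epsilon> > 0"
    define W where "W = {z \<in> topspace (prod_topology (euclidean :: 'g topology) X).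
       \<bar>p (case z of (g, y) \<Rightarrow> act g y) - p (snd z)\<bar> \<in> {..<\<epsilon>}}"
    have "openin (prod_topology euclidean X) W"
      unfolding W_def
      by (rule openin_continuous_map_preimage[where Y = euclideanreal])
         (intro continuous_map_real_abs continuous_map_diff pact psnd, simp)
    moreover have "{0} \<times> topspace X \<subseteq> W"
      using \<open>\<epsilon> > 0\<close> act_zero by (auto simp: W_def)
    ultimately obtain U V where U: "openin euclidean U" "0 \<in> U" "topspace X \<subseteq> V" "U \<times> V \<subseteq> W"
      using tube_lemma_right[of euclidean X W "topspace X" 0] X by (auto simp: compact_space_def)
    have "\<bar>p (act h x) - p (act (g + h) x)\<bar> \<le> \<epsilon>" if "g \<in> U" for g h
    proof -
      have "(g, act h x) \<in> W"
        using U(3,4) that in_X[OF x] by blast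
      then show ?thesis
        using act_add[OF x, of g h] by (simp add: W_def abs_minus_commute)
    qed
    then show "\<exists>U. open U \<and> 0 \<in> U \<and> (\<forall>g\<in>U. \<forall>h. \<bar>p (act h x) - p (act (g + h) x)\<bar> \<le> \<epsilon>)"
      using U(1,2) by auto
  qed
qed

text \<open>The points at which \<open>g\<close> moves the value of \<open>p\<close> by at most
  \<open>\<epsilon>\<close> form a closed set. Points of one orbit witness the finite intersection
  property of these sets, and a point common to all of them is fixed because continuous functions
  separate points of \<open>X\<close>.\<close>

lemma extremely_amenable_if_almost_invariant_points:
  assumes almost: "\<And>(J :: (('g::topological_group_add \<Rightarrow> real) \<times> 'g) set) \<epsilon>.
      finite J \<Longrightarrow> fst ` J \<subseteq> RUCB \<Longrightarrow> \<epsilon> > 0 \<Longrightarrow> \<exists>x. \<forall>(f, g)\<in>J. \<bar>f (g + x) - f x\<bar> \<le> \<epsilon>"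
  shows "extremely_amenable TYPE('g) TYPE('x)"
  unfolding extremely_amenable_def
proof (intro allI impI, elim conjE)
  fix X :: "'x topology" and act :: "'g \<Rightarrow> 'x \<Rightarrow> 'x"
  assume nonempty: "topspace X \<noteq> {}" and X: "compact_space X" "Hausdorff_space X"
    and act: "continuous_action X act"
  have act_cont: "continuous_map (prod_topology euclidean X) X (\<lambda>(g, x). act g x)"
    and act_add: "\<And>g h y. y \<in> topspace X \<Longrightarrow> act (g + h) y = act g (act h y)"
    using act unfolding continuous_action_def by blast+
  have in_X: "act g y \<in> topspace X" if "y \<in> topspace X" for g y
    using continuous_map_funspace[OF act_cont] that by (auto simp: Pi_iff)
  have act_g: "continuous_map X X (act g)" for g
  proof -
    have "continuous_map X (prod_topology euclidean X) (\<lambda>y. (g, y))"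
      by (simp add: continuous_map_paired)
    then show ?thesis
      using continuous_map_compose[OF _ act_cont] by (fastforce simp: comp_def)
  qed
  obtain x0 where x0: "x0 \<in> topspace X" using nonempty by blast
  define S where "S = (\<lambda>(p, g, \<epsilon>). {y \<in> topspace X. \<bar>p (act g y) - p y\<bar> \<in> {..\<epsilon>::real}})"
  define T where "T = {(p, g :: 'g, \<epsilon> :: real). continuous_map X euclideanreal p \<and> \<epsilon> > 0}"
  have closed: "closedin X (S j)" if j: "j \<in> T" for j
  proof -
    obtain p g \<epsilon> where j': "j = (p, g, \<epsilon>)" by (cases j)
    with j have p: "continuous_map X euclideanreal p" by (simp add: T_def)
    have "continuous_map X euclideanreal (\<lambda>y. p (act g y))"
      using continuous_map_compose[OF act_g p] by (simp add: comp_def)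
    then show ?thesis
      unfolding S_def j' prod.case
      by (intro closedin_continuous_map_preimage[where Y = euclideanreal]
            continuous_map_real_abs continuous_map_diff p) simp_all
  qed
  have fip: "\<Inter>\<F> \<noteq> {}" if \<F>: "finite \<F>" "\<F> \<subseteq> S ` T" for \<F>
  proof -
    obtain K where K: "K \<subseteq> T" "finite K" "\<F> = S ` K"
      using finite_subset_image[OF \<F>] by blast
    \<comment> \<open>The finitely many conditions are pulled back to the group along the orbit map
      of \<open>x0\<close>, with their smallest tolerance as common bound; the 1 in the minimum
      covers empty \<open>K\<close>.\<close>
    define J where "J = (\<lambda>(p, g, \<epsilon>). ((\<lambda>h. p (act h x0), g))) ` K"
    define \<epsilon> where "\<epsilon> = Min (insert 1 ((\<lambda>(p, g, \<epsilon>). \<epsilon>) ` K))"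
    have "\<epsilon> > 0"
      unfolding \<epsilon>_def using K by (subst Min_gr_iff) (auto simp: T_def)
    have "finite J" using K by (simp add: J_def)
    moreover have "fst ` J \<subseteq> RUCB"
      using K(1) orbit_function_RUCB[OF X(1) act x0] by (auto simp: J_def T_def)
    ultimately obtain h where h: "\<forall>(f, g)\<in>J. \<bar>f (g + h) - f h\<bar> \<le> \<epsilon>"
      using almost \<open>\<epsilon> > 0\<close> by blast
    have "act h x0 \<in> S j" if j: "j \<in> K" for j
    proof -
      obtain p g \<eta> where j': "j = (p, g, \<eta>)" by (cases j)
      then have "((\<lambda>h. p (act h x0)), g) \<in> J"
        using j unfolding J_def by force
      then have "\<bar>p (act (g + h) x0) - p (act h x0)\<bar> \<le> \<epsilon>"
        using bspec[OF h] by fastforce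
      also have "\<epsilon> \<le> \<eta>"
        unfolding \<epsilon>_def using j j' K(2) by (intro Min_le) force+
      finally show ?thesis
        using act_add[OF x0] in_X[OF x0] by (simp add: S_def j')
    qed
    then show ?thesis using K(3) by blast
  qed
  have "\<Inter>(S ` T) \<noteq> {}"
    using X(1)[unfolded compact_space_fip, rule_format, of "S ` T"] closed fip by blast
  then obtain x where x: "\<And>j. j \<in> T \<Longrightarrow> x \<in> S j" by blast
  \<comment> \<open>One member of the family is needed to see that \<open>x\<close> lies in the
    space at all.\<close>
  have "((\<lambda>_. 0 :: real), 0 :: 'g, 1 :: real) \<in> T"
    by (simp add: T_def)
  then have xX: "x \<in> topspace X"
    using x unfolding S_def by fastforce
  have "act g x = x" for g
  proof (rule ccontr)
    assume neq: "act g x \<noteq> x"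
    have "normal_space X"
      using X compact_Hausdorff_or_regular_imp_normal_space by blast
    moreover have "closedin X {act g x}" "closedin X {x}"
      using X(2) in_X xX by (auto intro: closedin_Hausdorff_singleton)
    moreover have "disjnt {act g x} {x}"
      using neq by simp
    \<comment> \<open>A Urysohn function with values 0 and 1 at the two points contradicts the
      tolerance \<open>1 / 2\<close>.\<close>
    ultimately obtain p :: "'x \<Rightarrow> real" where
      p: "continuous_map X euclideanreal p" "p ` {act g x} \<subseteq> {0}" "p ` {x} \<subseteq> {1}"
      by (rule Urysohn_lemma_alt)
    then have "(p, g, 1 / 2) \<in> T" by (simp add: T_def)
    then have "\<bar>p (act g x) - p x\<bar> \<le> 1 / 2"
      using x unfolding S_def by fastforce
    then show False using p by simp
  qed
  then show "\<exists>x\<in>topspace X. \<forall>g. act g x = x"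
    using xX by blast
qed

section \<open>Simultaneous concentration of finitely many functions, and the conclusion\<close>

theorem corollary1p2:
  fixes d :: "'g::topological_group_add \<Rightarrow> 'g \<Rightarrow> real"
    and D :: "real set"
    and \<phi> :: "real \<Rightarrow> 'g \<Rightarrow> 'g"
  assumes "Metric_space UNIV d"
    and "Metric_space.mtopology UNIV d = euclidean"
    and "right_invariant d"
    and "D \<subseteq> {0..1}" and "{0..1} \<subseteq> closure D" and "{0, 1} \<subseteq> D"
    and "\<And>t. t \<in> D \<Longrightarrow> endomorphism (\<phi> t)"
    and "\<And>t. t \<in> D \<Longrightarrow> continuous_on UNIV (\<phi> t)"
    and "range (\<phi> 0) = {0}" and "range (\<phi> 1) = UNIV"
    and "\<And>s t. s \<in> D \<Longrightarrow> t \<in> D \<Longrightarrow> s \<le> t \<Longrightarrow> range (\<phi> s) \<subseteq> range (\<phi> t)"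
    and "\<exists>C\<ge>0. \<forall>s\<in>D. \<forall>t\<in>D. \<forall>g h. d (g + \<phi> s h) (g + \<phi> t h) \<le> C * \<bar>s - t\<bar>"
    and "amenable TYPE('g)"
  shows "extremely_amenable TYPE('g) TYPE('x)"
proof -
  obtain C where C: "C \<ge> 0"
    "\<And>s t g h. s \<in> D \<Longrightarrow> t \<in> D \<Longrightarrow> d (g + \<phi> s h) (g + \<phi> t h) \<le> C * \<bar>s - t\<bar>"
    using assms(12) by blast
  have conc: "\<exists>\<nu>. invariant_mean \<nu> \<and> (\<forall>f\<in>F. \<exists>c. \<nu> (\<lambda>x. (f x - c)\<^sup>2) \<le> \<epsilon>)"
    if F: "finite F" "F \<subseteq> RUCB" and "\<epsilon> > 0" for F :: "('g \<Rightarrow> real) set" and \<epsilon>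
  proof -
    \<comment> \<open>Replacing \<open>f\<close> by its approximant costs
      \<open>2 * \<eta>\<^sup>2 = \<epsilon> / 2\<close> in the mean squared deviation; the other
      half of \<open>\<epsilon>\<close> is left for twice the variance of the approximant.\<close>
    define \<eta> where "\<eta> = sqrt (\<epsilon> / 4)"
    have \<eta>: "\<eta> > 0" "\<eta>\<^sup>2 = \<epsilon> / 4"
      using \<open>\<epsilon> > 0\<close> by (auto simp: \<eta>_def)
    have "\<forall>f\<in>F. \<exists>h L. h \<in> RUCB \<and> L \<ge> 0 \<and> (\<forall>x y. \<bar>h x - h y\<bar> \<le> L * d x y) \<and> (\<forall>x. \<bar>f x - h x\<bar> \<le> \<eta>)"
      using RUCB_Lipschitz_approximation[OF assms(1-3) _ \<eta>(1)] F(2) by (metis subsetD)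
    then obtain h L where h: "\<And>f. f \<in> F \<Longrightarrow> h f \<in> RUCB" "\<And>f. f \<in> F \<Longrightarrow> L f \<ge> 0"
      "\<And>f x y. f \<in> F \<Longrightarrow> \<bar>h f x - h f y\<bar> \<le> L f * d x y" "\<And>f x. f \<in> F \<Longrightarrow> \<bar>f x - h f x\<bar> \<le> \<eta>"
      by metis
    \<comment> \<open>A positive common bound for the squared Lipschitz constants: concentration
      with parameter \<open>\<epsilon> / (4 * K)\<close> makes every variance at most
      \<open>\<epsilon> / 4\<close>.\<close>
    define K where "K = 1 + (\<Sum>f\<in>F. (L f)\<^sup>2)"
    have "K > 0" unfolding K_def by (intro add_pos_nonneg sum_nonneg) auto
    have LK: "(L f)\<^sup>2 \<le> K" if "f \<in> F" for f
      unfolding K_def using member_le_sum[OF that, of "\<lambda>f. (L f)\<^sup>2"] F(1) by simp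
    have "\<epsilon> / (4 * K) > 0" using \<open>\<epsilon> > 0\<close> \<open>K > 0\<close> by simp
    then obtain \<nu> where \<nu>: "invariant_mean \<nu>"
      "\<And>f L. f \<in> RUCB \<Longrightarrow> L \<ge> 0 \<Longrightarrow> (\<And>x y. \<bar>f x - f y\<bar> \<le> L * d x y) \<Longrightarrow>
         \<nu> (\<lambda>x. (f x)\<^sup>2) \<le> (\<nu> f)\<^sup>2 + \<epsilon> / (4 * K) * L\<^sup>2"
      using exists_concentrated_mean[OF assms(3,5,6,7,8,9,10) C assms(13)] by blast
    note mean = averaging_mean[OF \<nu>(1)]
    have "\<nu> (\<lambda>x. (f x - \<nu> (h f))\<^sup>2) \<le> \<epsilon>" if f: "f \<in> F" for f
    proof -
      define c where "c = \<nu> (h f)"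
      have "\<epsilon> / (4 * K) * (L f)\<^sup>2 \<le> \<epsilon> / 4"
        using LK[OF f] \<open>K > 0\<close> \<open>\<epsilon> > 0\<close> by (simp add: field_simps)
      moreover have "\<nu> (\<lambda>x. (h f x - c)\<^sup>2) = \<nu> (\<lambda>x. (h f x)\<^sup>2) - c\<^sup>2"
        using averaging_variance_eq[OF mean h(1)[OF f], of c] by (simp add: c_def)
      ultimately have var: "\<nu> (\<lambda>x. (h f x - c)\<^sup>2) \<le> \<epsilon> / 4"
        using \<nu>(2)[OF h(1,2,3)[OF f]] by (simp add: c_def)
      have "(f x - c)\<^sup>2 \<le> 2 * (h f x - c)\<^sup>2 + \<epsilon> / 2" for x
      proof -
        have "(f x - h f x)\<^sup>2 \<le> \<eta>\<^sup>2"
          using h(4)[OF f, of x] by (metis abs_ge_zero power2_abs power_mono)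
        then show ?thesis
          using square_sum_le[of "h f x - c" "f x - h f x"] \<eta>(2) by simp
      qed
      then have "\<nu> (\<lambda>x. (f x - c)\<^sup>2) \<le> \<nu> (\<lambda>x. 2 * (h f x - c)\<^sup>2 + \<epsilon> / 2)"
        using F(2) f h(1)[OF f] by (intro averaging_mono[OF mean] RUCB_intros) auto
      also have "\<dots> = \<nu> (\<lambda>x. 2 * (h f x - c)\<^sup>2) + \<nu> (\<lambda>x. \<epsilon> / 2)"
        by (intro averaging_add[OF mean] RUCB_intros h(1) f)
      also have "\<nu> (\<lambda>x. \<epsilon> / 2) = \<epsilon> / 2"
        by (rule averaging_const[OF mean])
      also have "\<nu> (\<lambda>x. 2 * (h f x - c)\<^sup>2) = 2 * \<nu> (\<lambda>x. (h f x - c)\<^sup>2)"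
        by (intro averaging_cmult[OF mean] RUCB_intros h(1) f)
      finally show ?thesis using var by (simp add: c_def)
    qed
    then show ?thesis using \<nu>(1) by blast
  qed
  show ?thesis
  proof (rule extremely_amenable_if_almost_invariant_points)
    fix J :: "(('g \<Rightarrow> real) \<times> 'g) set" and \<epsilon> :: real
    assume "finite J" "fst ` J \<subseteq> RUCB" "\<epsilon> > 0"
    then show "\<exists>x. \<forall>(f, g)\<in>J. \<bar>f (g + x) - f x\<bar> \<le> \<epsilon>"
      using exists_almost_invariant_point[OF conc] by (metis (no_types, lifting) case_prodI2)
  qed
qed

end
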